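(* Fix an integer $k\ge 0$. Let $X$ be a finite clique complex such that every strongly connected, pure $(k+1)$-dimensional subcomplex $S\subseteq X$ contains at least one vertex $v$ with $\deg_S(v)\le 2k+1$. Then $X$ is $(k+1)$-collapsible.
   Context: A simplicial complex is a clique complex (flag complex) if it is the maximal simplicial complex supported on its edge set, i.e. every complete subgraph of its 1-skeleton is filled in with a simplex. For a vertex $v$ of a complex $S$, $\deg_S(v)$ is the degree of $v$ in the 1-skeleton of $S$ (the number of edges of $S$ containing $v$). A $d$-dimensional simplicial complex is pure if all of its maximal faces are $d$-dimensional. A pure $d$-dimensional complex is strongly connected if for every pair of its $d$-faces $\sigma,\tau$ there is a sequence of $d$-faces $\sigma=\sigma_0,\sigma_1,\ldots,\sigma_j=\tau$ of it such that $\sigma_i\cap\sigma_{i+1}$ is a $(d-1)$-face for every $i$. Let $\Delta$ be a simplicial complex with (nonempty) faces $\sigma\subsetneq\tau$ such that $\tau$ is a maximal face of $\Delta$ and $\sigma$ is contained in no other maximal face of $\Delta$. Then $\sigma$ is called a free face of $\tau$, and the simplicial collapse of the interval $[\sigma,\tau]$ is the removal from $\Delta$ of all faces $\eta$ with $\sigma\subseteq\eta\subseteq\tau$. A complex is $m$-collapsible if all its faces of dimension at least $m$ can be collapsed, i.e. there is a finite (possibly empty) sequence of simplicial collapses reducing it to a complex of dimension at most $m-1$. *)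

theory Defs
  imports Main
begin

text \<open>Abstract simplicial complexes are represented by their sets of nonempty faces; the empty set
  is never counted as a face. The vertices of \<open>S\<close> are the elements of \<open>\<Union> S\<close>.\<close>

definition simplicial_complex :: "'a set set \<Rightarrow> bool" where
  "simplicial_complex S \<longleftrightarrow>
     (\<forall>\<sigma>\<in>S. finite \<sigma> \<and> \<sigma> \<noteq> {}) \<and>
     (\<forall>\<sigma>\<in>S. \<forall>\<rho>. \<rho> \<noteq> {} \<longrightarrow> \<rho> \<subseteq> \<sigma> \<longrightarrow> \<rho> \<in> S)"

definition face_dim :: "'a set \<Rightarrow> int" where
  "face_dim \<sigma> = int (card \<sigma>) - 1"

definition edges :: "'a set set \<Rightarrow> 'a set set" where
  "edges S = {e \<in> S. face_dim e = 1}"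

definition vertex_degree :: "'a set set \<Rightarrow> 'a \<Rightarrow> nat" where
  "vertex_degree S v = card {e \<in> edges S. v \<in> e}"

definition clique_complex :: "'a set set \<Rightarrow> bool" where
  "clique_complex X \<longleftrightarrow> simplicial_complex X \<and>
     (\<forall>\<sigma>. finite \<sigma> \<longrightarrow> \<sigma> \<noteq> {} \<longrightarrow> \<sigma> \<subseteq> \<Union> X \<longrightarrow>
        (\<forall>u\<in>\<sigma>. \<forall>v\<in>\<sigma>. u \<noteq> v \<longrightarrow> {u, v} \<in> edges X) \<longrightarrow> \<sigma> \<in> X)"

definition maximal_face :: "'a set set \<Rightarrow> 'a set \<Rightarrow> bool" where
  "maximal_face S \<tau> \<longleftrightarrow> \<tau> \<in> S \<and> (\<forall>\<rho>\<in>S. \<tau> \<subseteq> \<rho> \<longrightarrow> \<rho> = \<tau>)"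

definition complex_of_dim :: "nat \<Rightarrow> 'a set set \<Rightarrow> bool" where
  "complex_of_dim d S \<longleftrightarrow> simplicial_complex S \<and>
     (\<exists>\<sigma>\<in>S. face_dim \<sigma> = int d) \<and> (\<forall>\<sigma>\<in>S. face_dim \<sigma> \<le> int d)"

definition pure_complex :: "nat \<Rightarrow> 'a set set \<Rightarrow> bool" where
  "pure_complex d S \<longleftrightarrow> complex_of_dim d S \<and>
     (\<forall>\<tau>. maximal_face S \<tau> \<longrightarrow> face_dim \<tau> = int d)"

text \<open>Membership of the intersections in \<open>S\<close> is not demanded below: the intersection of two faces
  is again a face unless it is empty, and it can be empty only for \<open>d = 0\<close>, where it is the empty
  face of dimension \<open>-1\<close>.\<close>

definition strongly_connected :: "nat \<Rightarrow> 'a set set \<Rightarrow> bool" where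
  "strongly_connected d S \<longleftrightarrow>
     (\<forall>\<sigma>\<in>S. \<forall>\<tau>\<in>S. face_dim \<sigma> = int d \<longrightarrow> face_dim \<tau> = int d \<longrightarrow>
        (\<exists>(j::nat) s. s 0 = \<sigma> \<and> s j = \<tau> \<and>
           (\<forall>i\<le>j. s i \<in> S \<and> face_dim (s i) = int d) \<and>
           (\<forall>i<j. face_dim (s i \<inter> s (Suc i)) = int d - 1)))"

definition free_face :: "'a set set \<Rightarrow> 'a set \<Rightarrow> 'a set \<Rightarrow> bool" where
  "free_face S \<sigma> \<tau> \<longleftrightarrow> \<sigma> \<in> S \<and> \<sigma> \<subset> \<tau> \<and> maximal_face S \<tau> \<and>
     (\<forall>\<rho>. maximal_face S \<rho> \<longrightarrow> \<sigma> \<subseteq> \<rho> \<longrightarrow> \<rho> = \<tau>)"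

definition collapse_step :: "'a set set \<Rightarrow> 'a set set \<Rightarrow> bool" where
  "collapse_step S T \<longleftrightarrow>
     (\<exists>\<sigma> \<tau>. free_face S \<sigma> \<tau> \<and> T = S - {\<eta>. \<sigma> \<subseteq> \<eta> \<and> \<eta> \<subseteq> \<tau>})"

definition collapsible :: "nat \<Rightarrow> 'a set set \<Rightarrow> bool" where
  "collapsible m S \<longleftrightarrow>
     (\<exists>T. collapse_step\<^sup>*\<^sup>* S T \<and> (\<forall>\<sigma>\<in>T. face_dim \<sigma> \<le> int m - 1))"

end

theory Submission
  imports Defs
begin

text \<open>A flag complex with at most \<open>2m + 1\<close> vertices collapses to dimension below \<open>m\<close>: it is a cone,
  or some vertex has a link with at most \<open>2m - 1\<close> vertices, and then one collapses the star of that
  vertex by induction and continues with the deletion. In the theorem this applies to the link of a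
  low-degree vertex \<open>v\<close> of a strongly connected component. Only elementary collapses of pairs of
  sizes \<open>n\<close> and \<open>n + 1\<close> with \<open>n \<ge> k + 1\<close> are used; such a pair lies within one connected component
  of the comparability order on the faces with at least \<open>k + 1\<close> vertices, so that collapsing the flag
  link restricts to the component. Once the star of \<open>v\<close> is gone, the rest of the component is
  a union of components of the subcomplex induced on the vertices other than \<open>v\<close>, and one inducts.\<close>

section \<open>Elementary collapses in families of finite sets\<close>

text \<open>The lower set of a pair may have size exactly \<open>m\<close>, so that a set of size
  \<open>m + 1\<close> can be removed together with a free face of size \<open>m\<close>.\<close>

definition elem_collapse :: "nat \<Rightarrow> 'a set set \<Rightarrow> 'a set set \<Rightarrow> bool" where
  "elem_collapse m S T \<longleftrightarrow> (\<exists>\<sigma>\<in>S. \<exists>\<tau>\<in>S. m \<le> card \<sigma> \<and> finite \<tau> \<and> \<sigma> \<subset> \<tau> \<and>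
     card \<tau> = Suc (card \<sigma>) \<and> (\<forall>\<rho>\<in>S. \<sigma> \<subset> \<rho> \<longrightarrow> \<rho> = \<tau>) \<and> T = S - {\<sigma>, \<tau>})"

text \<open>Applied to families that need not be complexes, and may contain the empty set: in a link it
  stands for the vertex itself.\<close>

definition collapses_below :: "nat \<Rightarrow> 'a set set \<Rightarrow> bool" where
  "collapses_below m S \<longleftrightarrow> (\<exists>T. (elem_collapse m)\<^sup>*\<^sup>* S T \<and> (\<forall>\<rho>\<in>T. card \<rho> \<le> m))"

definition up_closed_in :: "'a set set \<Rightarrow> 'a set set \<Rightarrow> bool" where
  "up_closed_in F Y \<longleftrightarrow> F \<subseteq> Y \<and> (\<forall>\<sigma>\<in>F. \<forall>\<rho>\<in>Y. \<sigma> \<subset> \<rho> \<longrightarrow> \<rho> \<in> F)"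

text \<open>Such an \<open>F\<close> is a union of connected components of the comparability graph
  of \<open>P\<close>.\<close>

definition comparability_closed_in :: "'a set set \<Rightarrow> 'a set set \<Rightarrow> bool" where
  "comparability_closed_in F P \<longleftrightarrow> F \<subseteq> P \<and> (\<forall>\<sigma>\<in>F. \<forall>\<rho>\<in>P. \<sigma> \<subset> \<rho> \<or> \<rho> \<subset> \<sigma> \<longrightarrow> \<rho> \<in> F)"

lemma elem_collapseI:
  "\<sigma> \<in> S \<Longrightarrow> \<tau> \<in> S \<Longrightarrow> m \<le> card \<sigma> \<Longrightarrow> finite \<tau> \<Longrightarrow> \<sigma> \<subset> \<tau> \<Longrightarrow> card \<tau> = Suc (card \<sigma>) \<Longrightarrow>
   (\<And>\<rho>. \<rho> \<in> S \<Longrightarrow> \<sigma> \<subset> \<rho> \<Longrightarrow> \<rho> = \<tau>) \<Longrightarrow> T = S - {\<sigma>, \<tau>} \<Longrightarrow> elem_collapse m S T"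
  unfolding elem_collapse_def by blast

lemma comparability_closed_inI:
  "F \<subseteq> P \<Longrightarrow> (\<And>\<sigma> \<rho>. \<sigma> \<in> F \<Longrightarrow> \<rho> \<in> P \<Longrightarrow> \<sigma> \<subset> \<rho> \<or> \<rho> \<subset> \<sigma> \<Longrightarrow> \<rho> \<in> F) \<Longrightarrow>
   comparability_closed_in F P"
  unfolding comparability_closed_in_def by (intro conjI ballI impI)

lemma comparability_closed_in_subset: "comparability_closed_in F P \<Longrightarrow> F \<subseteq> P"
  unfolding comparability_closed_in_def by simp

lemma comparability_closed_inD:
  "comparability_closed_in F P \<Longrightarrow> \<sigma> \<in> F \<Longrightarrow> \<rho> \<in> P \<Longrightarrow> \<sigma> \<subset> \<rho> \<or> \<rho> \<subset> \<sigma> \<Longrightarrow> \<rho> \<in> F"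
  unfolding comparability_closed_in_def by metis

lemma collapses_below_trivial:
  "(\<And>\<rho>. \<rho> \<in> S \<Longrightarrow> card \<rho> \<le> m) \<Longrightarrow> collapses_below m S"
  unfolding collapses_below_def by blast

text \<open>Freeness of a set depends only on the sets above it, and whatever lies in
  \<open>Y\<close> above a member of \<open>F\<close> belongs to \<open>F\<close>. The second
  conclusion allows the first to be iterated.\<close>

lemma elem_collapse_lift:
  assumes up: "up_closed_in F Y" and step: "elem_collapse m F F'"
  shows "elem_collapse m Y (Y - (F - F')) \<and> up_closed_in F' (Y - (F - F'))"
proof -
  obtain \<sigma> \<tau> where s: "\<sigma> \<in> F" "\<tau> \<in> F" "m \<le> card \<sigma>" "finite \<tau>" "\<sigma> \<subset> \<tau>"
    "card \<tau> = Suc (card \<sigma>)" "\<forall>\<rho>\<in>F. \<sigma> \<subset> \<rho> \<longrightarrow> \<rho> = \<tau>" and F': "F' = F - {\<sigma>, \<tau>}"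
    using step unfolding elem_collapse_def by blast
  have FY: "F \<subseteq> Y" using up unfolding up_closed_in_def by simp
  have upD: "\<rho> \<in> F" if "\<sigma>' \<in> F" "\<rho> \<in> Y" "\<sigma>' \<subset> \<rho>" for \<sigma>' \<rho>
    using up that unfolding up_closed_in_def by auto
  have e: "Y - (F - F') = Y - {\<sigma>, \<tau>}" using s(1,2) F' by auto
  have "\<sigma> \<in> Y" "\<tau> \<in> Y" using FY s(1,2) by auto
  then have "elem_collapse m Y (Y - {\<sigma>, \<tau>})"
    by (rule elem_collapseI[OF _ _ s(3-6)]) (use s(1,7) upD in auto)
  moreover have "up_closed_in F' (Y - {\<sigma>, \<tau>})"
    using F' FY upD unfolding up_closed_in_def by auto
  ultimately show ?thesis unfolding e by simp
qed

lemma elem_collapses_subset: "(elem_collapse m)\<^sup>*\<^sup>* F F' \<Longrightarrow> F' \<subseteq> F"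
  by (induction rule: rtranclp_induct) (auto simp: elem_collapse_def)

lemma elem_collapses_lift:
  assumes "(elem_collapse m)\<^sup>*\<^sup>* F F'" "up_closed_in F Y"
  shows "(elem_collapse m)\<^sup>*\<^sup>* Y (Y - (F - F')) \<and> up_closed_in F' (Y - (F - F'))"
  using assms
proof (induction rule: rtranclp_induct)
  case base
  then show ?case by simp
next
  case (step G H)
  let ?Z = "Y - (F - G)"
  have "elem_collapse m ?Z (?Z - (G - H)) \<and> up_closed_in H (?Z - (G - H))"
    using step by (intro elem_collapse_lift) auto
  moreover have "?Z - (G - H) = Y - (F - H)"
  proof -
    have "G \<subseteq> F" "H \<subseteq> G"
      using elem_collapses_subset[OF step(1)]
        elem_collapses_subset[OF r_into_rtranclp[of "elem_collapse m", OF step(2)]] by auto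
    then show ?thesis by blast
  qed
  ultimately show ?case using step by (auto intro: rtranclp.rtrancl_into_rtrancl)
qed

text \<open>Collapse \<open>F\<close> first. Its survivors have size at most \<open>m\<close>, so
  none of them lies strictly above a member of \<open>Y - F\<close>, whose sets have size at least
  \<open>m\<close>. Hence \<open>Y - F\<close> is up-closed in what remains and can be collapsed
  next.\<close>

lemma collapses_below_split:
  assumes fin: "\<And>\<rho>. \<rho> \<in> Y \<Longrightarrow> finite \<rho> \<and> m \<le> card \<rho>"
    and up: "up_closed_in F Y" and F: "collapses_below m F" and R: "collapses_below m (Y - F)"
  shows "collapses_below m Y"
proof -
  obtain F' where F': "(elem_collapse m)\<^sup>*\<^sup>* F F'" "\<forall>\<rho>\<in>F'. card \<rho> \<le> m"
    using F unfolding collapses_below_def by blast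
  obtain R' where R': "(elem_collapse m)\<^sup>*\<^sup>* (Y - F) R'" "\<forall>\<rho>\<in>R'. card \<rho> \<le> m"
    using R unfolding collapses_below_def by blast
  let ?Z = "Y - (F - F')"
  have 1: "(elem_collapse m)\<^sup>*\<^sup>* Y ?Z" using elem_collapses_lift[OF F'(1) up] by blast
  have "up_closed_in (Y - F) ?Z"
    unfolding up_closed_in_def
  proof (intro conjI ballI impI)
    fix \<sigma> \<rho> assume a: "\<sigma> \<in> Y - F" "\<rho> \<in> ?Z" "\<sigma> \<subset> \<rho>"
    then have "card \<sigma> < card \<rho>" using fin[of \<rho>] by (auto intro: psubset_card_mono)
    moreover have "m \<le> card \<sigma>" using fin a by blast
    ultimately have "\<rho> \<notin> F'" using F'(2) by force
    then show "\<rho> \<in> Y - F" using a by blast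
  qed auto
  from elem_collapses_lift[OF R'(1) this]
  have 2: "(elem_collapse m)\<^sup>*\<^sup>* ?Z (?Z - ((Y - F) - R'))" by blast
  have "?Z - ((Y - F) - R') \<subseteq> F' \<union> R'" by blast
  then show ?thesis unfolding collapses_below_def
    using rtranclp_trans[OF 1 2] F'(2) R'(2) by blast
qed

text \<open>The two sets of a collapsed pair are comparable, so \<open>M\<close> contains both or
  neither: the pairs in \<open>M\<close> collapse in the same order, and the others are
  skipped.\<close>

lemma elem_collapses_restrict:
  assumes "(elem_collapse m)\<^sup>*\<^sup>* F F'" "comparability_closed_in M F"
  shows "(elem_collapse m)\<^sup>*\<^sup>* M (M \<inter> F')"
  using assms
proof (induction rule: rtranclp_induct)
  case base
  then have "M \<inter> F = M" unfolding comparability_closed_in_def by blast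
  then show ?case by simp
next
  case (step G H)
  have GF: "G \<subseteq> F" using elem_collapses_subset[OF step(1)] .
  obtain \<sigma> \<tau> where s: "\<sigma> \<in> G" "\<tau> \<in> G" "m \<le> card \<sigma>" "finite \<tau>" "\<sigma> \<subset> \<tau>"
    "card \<tau> = Suc (card \<sigma>)" "\<forall>\<rho>\<in>G. \<sigma> \<subset> \<rho> \<longrightarrow> \<rho> = \<tau>" "H = G - {\<sigma>, \<tau>}"
    using step(2) unfolding elem_collapse_def by blast
  show ?case
  proof (cases "\<sigma> \<in> M")
    case True
    then have "\<tau> \<in> M"
      using subsetD[OF GF s(2)] s(5) step.prems unfolding comparability_closed_in_def by blast
    moreover have "M \<inter> H = M \<inter> G - {\<sigma>, \<tau>}" unfolding s(8) by blast
    ultimately have "elem_collapse m (M \<inter> G) (M \<inter> H)"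
      using True s(1,2,7) by (intro elem_collapseI[OF _ _ s(3-6)]) blast+
    then show ?thesis using step by (auto intro: rtranclp.rtrancl_into_rtrancl)
  next
    case False
    then have "\<tau> \<notin> M"
      using subsetD[OF GF s(1)] s(5) step.prems unfolding comparability_closed_in_def by blast
    then have "M \<inter> H = M \<inter> G" unfolding s(8) using False by blast
    then show ?thesis using step.IH[OF step.prems] by simp
  qed
qed

lemma collapses_below_restrict:
  "collapses_below m F \<Longrightarrow> comparability_closed_in M F \<Longrightarrow> collapses_below m M"
  unfolding collapses_below_def using elem_collapses_restrict by blast

text \<open>On sets avoiding \<open>v\<close>, adding \<open>v\<close> preserves and reflects
  inclusion and raises sizes by one. Collapses of the link of a vertex thereby become collapses of
  its star.\<close>

lemma elem_collapse_insert:
  assumes v: "v \<notin> \<Union> F" and step: "elem_collapse m F F'"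
  shows "elem_collapse (Suc m) (insert v ` F) (insert v ` F')"
proof -
  obtain \<sigma> \<tau> where s: "\<sigma> \<in> F" "\<tau> \<in> F" "m \<le> card \<sigma>" "finite \<tau>" "\<sigma> \<subset> \<tau>"
    "card \<tau> = Suc (card \<sigma>)" "\<forall>\<rho>\<in>F. \<sigma> \<subset> \<rho> \<longrightarrow> \<rho> = \<tau>" "F' = F - {\<sigma>, \<tau>}"
    using step unfolding elem_collapse_def by blast
  have nv: "v \<notin> \<sigma>" "v \<notin> \<tau>" using v s(1,2) by blast+
  have inj: "insert v \<rho> = insert v \<rho>' \<longleftrightarrow> \<rho> = \<rho>'" if "\<rho> \<in> F" "\<rho>' \<in> F" for \<rho> \<rho>'
    using v that by (metis UnionI insert_ident)
  have im: "insert v ` F' = insert v ` F - {insert v \<sigma>, insert v \<tau>}"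
    unfolding s(8) using s(1,2) inj by (auto simp del: insert_iff simp: image_iff)
  have fin: "finite \<sigma>" using s(4,5) finite_subset by blast
  show ?thesis
  proof (rule elem_collapseI[OF _ _ _ _ _ _ _ im])
    show "insert v \<sigma> \<in> insert v ` F" "insert v \<tau> \<in> insert v ` F" using s(1,2) by blast+
    show "Suc m \<le> card (insert v \<sigma>)" "finite (insert v \<tau>)"
      "card (insert v \<tau>) = Suc (card (insert v \<sigma>))"
      using s(3,4,6) fin nv by simp_all
    show "insert v \<sigma> \<subset> insert v \<tau>"
      using s(5) insert_ident[OF nv] by (metis insert_mono psubset_eq)
    fix \<rho> assume "\<rho> \<in> insert v ` F" "insert v \<sigma> \<subset> \<rho>"
    then obtain \<rho>' where \<rho>': "\<rho> = insert v \<rho>'" "\<rho>' \<in> F" "insert v \<sigma> \<subset> insert v \<rho>'" by blast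
    have "\<sigma> \<subseteq> insert v \<rho>'" using \<rho>'(3) by blast
    then have "\<sigma> \<subseteq> \<rho>'" using nv(1) by (metis subset_insert)
    moreover have "\<sigma> \<noteq> \<rho>'" using \<rho>'(3) by auto
    ultimately have "\<rho>' = \<tau>" using s(7) \<rho>'(2) by (metis psubsetI)
    then show "\<rho> = insert v \<tau>" using \<rho>'(1) by simp
  qed
qed

lemma collapses_below_insert:
  assumes "collapses_below m F" "v \<notin> \<Union> F"
  shows "collapses_below (Suc m) (insert v ` F)"
proof -
  obtain T where T: "(elem_collapse m)\<^sup>*\<^sup>* F T" "\<forall>\<rho>\<in>T. card \<rho> \<le> m"
    using assms(1) unfolding collapses_below_def by blast
  have "(elem_collapse (Suc m))\<^sup>*\<^sup>* (insert v ` F) (insert v ` T)"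
    using T(1)
  proof (induction rule: rtranclp_induct)
    case (step G H)
    have "v \<notin> \<Union> G" using elem_collapses_subset[OF step(1)] assms(2) by blast
    then show ?case using step elem_collapse_insert by (metis rtranclp.rtrancl_into_rtrancl)
  qed simp
  moreover have "card (insert v \<rho>) \<le> Suc m" if "\<rho> \<in> T" for \<rho>
    using T(2) that card_insert_le_m1[of "Suc m" \<rho> v] by auto
  ultimately show ?thesis unfolding collapses_below_def by blast
qed

section \<open>Cones and flag families on few vertices\<close>

text \<open>Each \<open>\<rho>\<close> avoiding \<open>v\<close> is paired with
  \<open>insert v \<rho>\<close>, and larger sets are collapsed first. The bound
  \<open>m < card \<rho>\<close> in the last hypothesis ensures that \<open>\<rho> - {v}\<close>
  still has size at least \<open>m\<close>.\<close>

lemma collapses_below_cone: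
  assumes "finite F" "\<And>\<rho>. \<rho> \<in> F \<Longrightarrow> finite \<rho> \<and> m \<le> card \<rho>"
    and "\<And>\<rho>. \<rho> \<in> F \<Longrightarrow> insert v \<rho> \<in> F"
    and "\<And>\<rho>. \<rho> \<in> F \<Longrightarrow> m < card \<rho> \<Longrightarrow> \<rho> - {v} \<in> F"
  shows "collapses_below m F"
  using assms
proof (induction "card F" arbitrary: F rule: less_induct)
  case less
  let ?B = "{\<rho>\<in>F. v \<notin> \<rho>}"
  show ?case
  proof (cases "?B = {}")
    case True
    \<comment> \<open>A set of size above \<open>m\<close> would, after deletion of
      \<open>v\<close>, yield a member of \<open>F\<close> avoiding \<open>v\<close>.\<close>
    then have "card \<rho> \<le> m" if "\<rho> \<in> F" for \<rho>
      using less.prems(4)[OF that] by (metis (mono_tags, lifting) Diff_iff empty_Collect_eq insertI1 not_le)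
    then show ?thesis by (rule collapses_below_trivial)
  next
    case False
    have "finite ?B" using less.prems(1) by simp
    then obtain \<sigma> where \<sigma>: "\<sigma> \<in> ?B" "Max (card ` ?B) = card \<sigma>"
      using False obtains_MAX[of ?B card] by blast
    have s: "\<sigma> \<in> ?B" "\<forall>\<rho>\<in>?B. card \<rho> \<le> card \<sigma>"
      using \<sigma>(1) Max_ge[OF finite_imageI[OF \<open>finite ?B\<close>], of _ card] unfolding \<sigma>(2) by blast+
    let ?G = "F - {\<sigma>, insert v \<sigma>}"
    \<comment> \<open>The maximal size of \<open>\<sigma>\<close> makes it free: a set strictly
      above it contains \<open>v\<close>, and deleting \<open>v\<close> gives a member that contains
      \<open>\<sigma>\<close>, avoids \<open>v\<close> and is no larger than
      \<open>\<sigma>\<close>.\<close>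
    have "\<rho> = insert v \<sigma>" if \<rho>: "\<rho> \<in> F" "\<sigma> \<subset> \<rho>" for \<rho>
    proof -
      have c: "card \<sigma> < card \<rho>" using less.prems(2)[OF \<rho>(1)] \<rho>(2) psubset_card_mono by blast
      then have "v \<in> \<rho>" using s(2) \<rho>(1) by force
      have "m < card \<rho>" using c less.prems(2)[of \<sigma>] s by simp
      then have d: "\<rho> - {v} \<in> ?B" using less.prems(4)[OF \<rho>(1)] by blast
      have "\<sigma> \<subseteq> \<rho> - {v}" using s(1) \<rho>(2) by blast
      moreover have "card (\<rho> - {v}) \<le> card \<sigma>" using d s(2) by blast
      ultimately have "\<sigma> = \<rho> - {v}" using card_seteq less.prems(2) d by blast
      then show ?thesis using \<open>v \<in> \<rho>\<close> by blast
    qed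
    then have step: "elem_collapse m F ?G"
      using s(1) less.prems(2,3)[of \<sigma>] by (intro elem_collapseI[of \<sigma> _ "insert v \<sigma>"]) auto
    have "card ?G < card F" using s(1) less.prems(1) by (intro psubset_card_mono) auto
    \<comment> \<open>Removing the whole pair keeps both closure hypotheses intact.\<close>
    moreover have "insert v \<rho> \<in> ?G" if "\<rho> \<in> ?G" for \<rho>
    proof -
      have "insert v \<rho> \<noteq> \<sigma>" using s(1) by blast
      moreover have "insert v \<rho> \<noteq> insert v \<sigma>"
      proof
        assume eq: "insert v \<rho> = insert v \<sigma>"
        show False
        proof (cases "v \<in> \<rho>")
          case True
          then show False using eq that by (simp add: insert_absorb)
        next
          case False
          then have "\<rho> = \<sigma>" using eq s(1) insert_ident[of v \<rho> \<sigma>] by blast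
          then show False using that by blast
        qed
      qed
      ultimately show ?thesis using less.prems(3) that by blast
    qed
    moreover have "\<rho> - {v} \<in> ?G" if "\<rho> \<in> ?G" "m < card \<rho>" for \<rho>
    proof -
      have "\<rho> - {v} \<noteq> \<sigma>" "\<rho> - {v} \<noteq> insert v \<sigma>" using that(1) s(1) by blast+
      then show ?thesis using less.prems(4) that by blast
    qed
    ultimately have "collapses_below m ?G"
      using less.prems by (intro less.hyps) auto
    then show ?thesis unfolding collapses_below_def
      using step by (meson converse_rtranclp_into_rtranclp)
  qed
qed

text \<open>This is the flag complex on \<open>N\<close> whose graph is the symmetric part of
  \<open>R\<close>, together with the empty face.\<close>

definition cliques :: "('a \<Rightarrow> 'a \<Rightarrow> bool) \<Rightarrow> 'a set \<Rightarrow> 'a set set" where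
  "cliques R N = {\<eta>. \<eta> \<subseteq> N \<and> (\<forall>x\<in>\<eta>. \<forall>y\<in>\<eta>. x \<noteq> y \<longrightarrow> R x y)}"

text \<open>Without a cone vertex, passing to the link of \<open>v\<close> loses at least two
  vertices and lowers \<open>m\<close> by one, which preserves the bound; deleting \<open>v\<close>
  keeps \<open>m\<close>. Hence the induction on \<open>card N\<close> leaves \<open>m\<close>
  arbitrary.\<close>

lemma cliques_few_vertices_collapse:
  assumes "finite N" "card N \<le> 2 * m + 1"
  shows "collapses_below m {\<eta>\<in>cliques R N. m \<le> card \<eta>}"
  using assms
proof (induction "card N" arbitrary: N m rule: less_induct)
  case less
  let ?F = "{\<eta>\<in>cliques R N. m \<le> card \<eta>}"
  have sub: "\<rho> \<subseteq> N" if "\<rho> \<in> ?F" for \<rho> using that unfolding cliques_def by blast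
  have fin: "finite \<rho>" if "\<rho> \<in> ?F" for \<rho>
    using finite_subset[OF sub[OF that] less.prems(1)] .
  have finF: "finite ?F"
    using finite_subset[of ?F "Pow N"] sub less.prems(1) by blast
  consider "N = {}" | (cone) v where "v \<in> N" "\<forall>u\<in>N - {v}. R u v \<and> R v u"
    | (nocone) v u where "v \<in> N" "u \<in> N - {v}" "\<not> (R u v \<and> R v u)"
    by blast
  then show ?case
  proof cases
    case 1
    then show ?thesis by (intro collapses_below_trivial) (auto simp: cliques_def)
  next
    case cone
    show ?thesis
    proof (rule collapses_below_cone[where v = v])
      fix \<rho> assume \<rho>: "\<rho> \<in> ?F"
      have "card \<rho> \<le> card (insert v \<rho>)" using fin[OF \<rho>] by (simp add: card_insert_le)
      then show "insert v \<rho> \<in> ?F" using \<rho> cone unfolding cliques_def by auto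
      show "\<rho> - {v} \<in> ?F" if "m < card \<rho>"
      proof -
        have "m \<le> card (\<rho> - {v})" using that fin[OF \<rho>] by (auto simp: card_Diff_singleton_if)
        then show ?thesis using \<rho> unfolding cliques_def by auto
      qed
    qed (use finF fin in blast)+
  next
    case nocone
    let ?L = "{w\<in>N - {v}. R w v \<and> R v w}"
    let ?V = "{\<eta>\<in>?F. v \<in> \<eta>}"
    \<comment> \<open>The non-neighbour \<open>u\<close> is the second vertex, besides
      \<open>v\<close> itself, that the link misses.\<close>
    have "?L \<subseteq> N - {u, v}" using nocone by blast
    then have "card ?L \<le> card (N - {u, v})" by (intro card_mono) (use less.prems in auto)
    also have "\<dots> = card N - 2" using nocone less.prems(1) by (subst card_Diff_subset) auto
    finally have cL: "card ?L \<le> card N - 2" .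
    have "card {u, v} \<le> card N" using nocone less.prems(1) by (intro card_mono) auto
    then have c2: "2 \<le> card N" using nocone by auto
    \<comment> \<open>Two vertices exclude \<open>m = 0\<close>, for which the bound allows only
      one.\<close>
    then obtain m' where m: "m = Suc m'" using less.prems(2) by (cases m) auto
    have IH: "collapses_below m' {\<eta>\<in>cliques R ?L. m' \<le> card \<eta>}"
      using cL c2 m less.prems by (intro less.hyps) auto
    have eq: "?V = insert v ` {\<eta>\<in>cliques R ?L. m' \<le> card \<eta>}"
    proof (intro equalityI subsetI)
      fix \<eta> assume h: "\<eta> \<in> ?V"
      then have "\<eta> - {v} \<in> cliques R ?L" unfolding cliques_def by auto
      moreover have "m' \<le> card (\<eta> - {v})" using h fin[of \<eta>] m by (auto simp: card_Diff_singleton_if)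
      moreover have "\<eta> = insert v (\<eta> - {v})" using h by blast
      ultimately show "\<eta> \<in> insert v ` {\<eta>\<in>cliques R ?L. m' \<le> card \<eta>}" by blast
    next
      fix \<eta> assume "\<eta> \<in> insert v ` {\<eta>\<in>cliques R ?L. m' \<le> card \<eta>}"
      then obtain \<rho> where \<rho>: "\<eta> = insert v \<rho>" "\<rho> \<in> cliques R ?L" "m' \<le> card \<rho>" by blast
      have "\<rho> \<subseteq> ?L" using \<rho> unfolding cliques_def by blast
      then have "finite \<rho>" "v \<notin> \<rho>" using finite_subset[of \<rho> N] less.prems(1) by blast+
      then show "\<eta> \<in> ?V" using \<rho> m nocone(1) unfolding cliques_def by auto
    qed
    have V: "collapses_below m ?V"
      using collapses_below_insert[OF IH, of v] eq m by (auto simp: cliques_def)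
    have "?F - ?V = {\<eta>\<in>cliques R (N - {v}). m \<le> card \<eta>}"
      unfolding cliques_def by auto
    moreover have "collapses_below m {\<eta>\<in>cliques R (N - {v}). m \<le> card \<eta>}"
    proof (rule less.hyps)
      show "card (N - {v}) < card N" using nocone(1) less.prems(1) by (intro psubset_card_mono) auto
      then show "card (N - {v}) \<le> 2 * m + 1" using less.prems(2) by simp
    qed (use less.prems in simp)
    ultimately have "collapses_below m (?F - ?V)" by simp
    moreover have "up_closed_in ?V ?F" unfolding up_closed_in_def by auto
    moreover have "finite \<rho> \<and> m \<le> card \<rho>" if "\<rho> \<in> ?F" for \<rho> using fin[OF that] that by simp
    ultimately show ?thesis using V by (intro collapses_below_split[of ?F m ?V])
  qed
qed

section \<open>The star of a vertex with few neighbours\<close>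

text \<open>The link of \<open>v\<close> in \<open>D\<close>, restricted to the neighbours
  \<open>?N\<close>, is a union of components of the flag family on \<open>?N\<close>, so the
  collapse of that family restricts to it. Neighbours are counted through sets of size
  \<open>m + 2\<close>, the facets of the pure complex to which the degree hypothesis will be
  applied.\<close>

lemma few_neighbours_star_collapses:
  assumes X: "clique_complex X" "finite X"
    and D: "comparability_closed_in D {B\<in>X. B \<subseteq> W \<and> Suc m \<le> card B}"
    and N: "card {u. u \<noteq> v \<and> (\<exists>B\<in>D. card B = m + 2 \<and> u \<in> B \<and> v \<in> B)} \<le> 2 * m + 1"
      (is "card ?N \<le> _")
  shows "collapses_below (Suc m) {B\<in>D. v \<in> B}" (is "collapses_below _ ?Dv")
proof -
  have sc: "simplicial_complex X" using X(1) unfolding clique_complex_def by blast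
  have finX: "finite B" if "B \<in> X" for B using sc that unfolding simplicial_complex_def by blast
  have subX: "C \<in> X" if "B \<in> X" "C \<subseteq> B" "C \<noteq> {}" for B C
    using sc that unfolding simplicial_complex_def by blast
  have DX: "B \<in> X" "B \<subseteq> W" "Suc m \<le> card B" if "B \<in> D" for B
    using subsetD[OF comparability_closed_in_subset[OF D] that] by auto
  have Dcl: "C \<in> D" if "B \<in> D" "C \<in> X" "C \<subseteq> W" "Suc m \<le> card C" "B \<subset> C \<or> C \<subset> B" for B C
    using comparability_closed_inD[OF D that(1) _ that(5)] that(2-4) by simp
  have NX: "{u, v} \<in> X" "u \<in> W" "u \<in> \<Union> X" if u: "u \<in> ?N" for u
  proof -
    obtain B where B: "B \<in> D" "u \<in> B" "v \<in> B" using u by blast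
    show "{u, v} \<in> X" using subX[OF DX(1)[OF B(1)], of "{u, v}"] B by simp
    show "u \<in> W" using DX(2)[OF B(1)] B(2) by blast
    show "u \<in> \<Union> X" using DX(1)[OF B(1)] B(2) by blast
  qed
  have "finite (\<Union> X)" using X(2) finX by blast
  then have finN: "finite ?N" using NX(3) finite_subset[of ?N "\<Union> X"] by blast
  define R where "R = (\<lambda>u w. {u, w} \<in> X)"
  define K where "K = {\<eta>\<in>cliques R ?N. m \<le> card \<eta>}"
  define L where "L = {\<eta>. \<eta> \<subseteq> ?N \<and> insert v \<eta> \<in> D}"
  have LK: "\<eta> \<in> K" if "\<eta> \<in> L" for \<eta>
  proof -
    have h: "\<eta> \<subseteq> ?N" "insert v \<eta> \<in> D" using that unfolding L_def by auto
    have "finite \<eta>" using finN h(1) finite_subset by blast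
    moreover have "v \<notin> \<eta>" using h(1) by blast
    ultimately have "m \<le> card \<eta>" using DX(3)[OF h(2)] by simp
    moreover have "R x y" if "x \<in> \<eta>" "y \<in> \<eta>" for x y
      unfolding R_def using that by (intro subX[OF DX(1)[OF h(2)]]) auto
    ultimately show ?thesis using h(1) unfolding K_def cliques_def by auto
  qed
  \<comment> \<open>Flagness of \<open>X\<close> enters here: a clique \<open>\<rho>\<close> of
    neighbours of \<open>v\<close> spans a face together with \<open>v\<close>. Being comparable to
    the member \<open>insert v \<sigma>\<close> of \<open>D\<close>, this face lies in
    \<open>D\<close> as well.\<close>
  have "comparability_closed_in L K"
  proof (rule comparability_closed_inI)
    show "L \<subseteq> K" using LK by blast
    fix \<sigma> \<rho> assume \<sigma>: "\<sigma> \<in> L" and \<rho>: "\<rho> \<in> K" and cmp: "\<sigma> \<subset> \<rho> \<or> \<rho> \<subset> \<sigma>"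
    have s: "\<sigma> \<subseteq> ?N" "insert v \<sigma> \<in> D" using \<sigma> unfolding L_def by auto
    have r: "\<rho> \<subseteq> ?N" "m \<le> card \<rho>" "\<And>x y. x \<in> \<rho> \<Longrightarrow> y \<in> \<rho> \<Longrightarrow> x \<noteq> y \<Longrightarrow> {x, y} \<in> X"
      using \<rho> unfolding K_def cliques_def R_def by auto
    have nv: "v \<notin> \<sigma>" "v \<notin> \<rho>" using s(1) r(1) by blast+
    have finr: "finite \<rho>" using r(1) finN finite_subset by blast
    have vX: "v \<in> \<Union> X" "v \<in> W" using DX[OF s(2)] by blast+
    have vR: "{x, v} \<in> X" "{v, x} \<in> X" if "x \<in> \<rho>" for x
      using NX(1)[of x] r(1) that by (auto simp: insert_commute)
    have pairs: "{x, y} \<in> edges X" if "x \<in> insert v \<rho>" "y \<in> insert v \<rho>" "x \<noteq> y" for x y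
    proof -
      have "{x, y} \<in> X" using that r(3) vR by blast
      then show ?thesis using that(3) unfolding edges_def face_dim_def by simp
    qed
    have "insert v \<rho> \<subseteq> \<Union> X" using vX(1) r(1) NX(3) by blast
    then have "insert v \<rho> \<in> X"
      using X(1) pairs finr unfolding clique_complex_def by (meson finite_insert insert_not_empty)
    moreover have "insert v \<rho> \<subseteq> W" using vX(2) r(1) NX(2) by blast
    moreover have "Suc m \<le> card (insert v \<rho>)" using r(2) nv(2) finr by simp
    moreover have "insert v \<sigma> \<subset> insert v \<rho> \<or> insert v \<rho> \<subset> insert v \<sigma>"
      using cmp nv by (metis insert_ident insert_mono psubset_eq)
    ultimately have "insert v \<rho> \<in> D" using Dcl[OF s(2)] by blast
    then show "\<rho> \<in> L" using r(1) unfolding L_def by simp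
  qed
  moreover have "collapses_below m K"
    unfolding K_def using cliques_few_vertices_collapse[OF finN N] .
  ultimately have "collapses_below m L" using collapses_below_restrict by blast
  then have colL: "collapses_below (Suc m) (insert v ` L)"
    by (rule collapses_below_insert) (auto simp: L_def)
  \<comment> \<open>Each \<open>u\<close> other than \<open>v\<close> in such a
    \<open>\<rho>\<close> lies with \<open>v\<close> in a subset of size \<open>m + 2\<close>. That
    subset is comparable or equal to \<open>\<rho>\<close>, hence in \<open>D\<close>, so
    \<open>u\<close> is counted in \<open>?N\<close>.\<close>
  have big: "\<rho> \<in> insert v ` L" if \<rho>: "\<rho> \<in> D" "v \<in> \<rho>" "m + 2 \<le> card \<rho>" for \<rho>
  proof -
    have "u \<in> ?N" if u: "u \<in> \<rho> - {v}" for u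
    proof -
      have "finite \<rho>" using finX DX(1) \<rho>(1) by blast
      moreover have "card {u, v} \<le> m + 2" "{u, v} \<subseteq> \<rho>" using u \<rho>(2) by auto
      ultimately obtain B where B: "{u, v} \<subseteq> B" "B \<subseteq> \<rho>" "card B = m + 2"
        using exists_subset_between[of "{u, v}" "m + 2" \<rho>] \<rho>(3) by metis
      have "B \<in> X" using subX[OF DX(1)[OF \<rho>(1)] B(2)] B(1) by blast
      moreover have "B \<subseteq> W" using B(2) DX(2)[OF \<rho>(1)] by blast
      ultimately have "B \<in> D" using Dcl[OF \<rho>(1), of B] B \<rho>(1)
        by (metis Suc_leI add_2_eq_Suc' lessI less_Suc_eq psubsetI)
      then show ?thesis using B u by blast
    qed
    then have "\<rho> - {v} \<in> L" unfolding L_def using \<rho>(1,2) by (auto simp: insert_absorb)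
    moreover have "\<rho> = insert v (\<rho> - {v})" using \<rho>(2) by blast
    ultimately show ?thesis by blast
  qed
  \<comment> \<open>Outside the image of \<open>L\<close> only sets of size \<open>m + 1\<close>
    remain, and these may survive.\<close>
  show ?thesis
  proof (rule collapses_below_split[OF _ _ colL])
    show "finite \<rho> \<and> Suc m \<le> card \<rho>" if "\<rho> \<in> ?Dv" for \<rho>
      using that DX finX by blast
    show "up_closed_in (insert v ` L) ?Dv"
      unfolding up_closed_in_def
    proof (intro conjI ballI impI)
      show "insert v ` L \<subseteq> ?Dv" unfolding L_def by blast
      fix \<sigma> \<rho> assume \<sigma>: "\<sigma> \<in> insert v ` L" and \<rho>: "\<rho> \<in> ?Dv" and "\<sigma> \<subset> \<rho>"
      then have "card \<sigma> < card \<rho>" using DX(1) finX by (intro psubset_card_mono) blast+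
      moreover have "Suc m \<le> card \<sigma>" using \<sigma> DX(3) unfolding L_def by blast
      ultimately show "\<rho> \<in> insert v ` L" using big \<rho> by simp
    qed
    show "collapses_below (Suc m) (?Dv - insert v ` L)"
    proof (rule collapses_below_trivial)
      fix \<rho> assume "\<rho> \<in> ?Dv - insert v ` L"
      then have "\<not> m + 2 \<le> card \<rho>" using big by blast
      then show "card \<rho> \<le> Suc m" by simp
    qed
  qed
qed

section \<open>Adjacency of facets versus comparability of faces\<close>

text \<open>For sets of size \<open>n + 1\<close> this is the adjacency of strong connectivity: an
  intersection with \<open>n\<close> vertices has dimension \<open>n - 1\<close>.\<close>

definition facet_graph :: "nat \<Rightarrow> 'a set set \<Rightarrow> ('a set \<times> 'a set) set" where
  "facet_graph n T = {(\<sigma>, \<tau>). \<sigma> \<in> T \<and> \<tau> \<in> T \<and> card (\<sigma> \<inter> \<tau>) = n}"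

lemma sym_facet_graph: "sym (facet_graph n T)"
  by (rule symI) (simp add: facet_graph_def Int_commute)

text \<open>Exchanging a vertex of \<open>\<sigma> - \<tau>\<close> for one of
  \<open>\<tau> - \<sigma>\<close> leads to an adjacent facet inside \<open>B\<close> that is closer
  to \<open>\<tau>\<close>.\<close>

lemma simplex_facet_connected:
  assumes "finite B" "\<And>\<rho>. \<rho> \<subseteq> B \<Longrightarrow> card \<rho> = Suc n \<Longrightarrow> \<rho> \<in> T"
    and "\<sigma> \<subseteq> B" "card \<sigma> = Suc n" "\<tau> \<subseteq> B" "card \<tau> = Suc n"
  shows "(\<sigma>, \<tau>) \<in> (facet_graph n T)\<^sup>*"
  using assms
proof (induction "card (\<sigma> - \<tau>)" arbitrary: \<sigma>)
  case 0
  have fin: "finite \<sigma>" "finite \<tau>" using 0 finite_subset by blast+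
  then have "\<sigma> \<subseteq> \<tau>" using 0(1) by simp
  then have "\<sigma> = \<tau>" using card_seteq[OF fin(2)] 0 by simp
  then show ?case by simp
next
  case (Suc c)
  have fin: "finite \<sigma>" "finite \<tau>" using Suc.prems finite_subset by blast+
  obtain x where x: "x \<in> \<sigma>" "x \<notin> \<tau>"
    using Suc.hyps(2) by (metis DiffE card.empty ex_in_conv nat.distinct(1))
  have "\<not> \<tau> \<subseteq> \<sigma>" using card_seteq[OF fin(1), of \<tau>] Suc.prems x by auto
  then obtain y where y: "y \<in> \<tau>" "y \<notin> \<sigma>" by blast
  let ?\<sigma> = "insert y (\<sigma> - {x})"
  have c1: "card (\<sigma> - {x}) = n" using fin(1) x(1) Suc.prems(4) by simp
  have s: "?\<sigma> \<subseteq> B" using Suc.prems(3,5) y(1) by blast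
  have c2: "card ?\<sigma> = Suc n" using c1 fin(1) y(2) by simp
  have "?\<sigma> - \<tau> = (\<sigma> - \<tau>) - {x}" using y(1) by blast
  then have c: "c = card (?\<sigma> - \<tau>)" using Suc.hyps(2) x fin(1) by simp
  have "(?\<sigma>, \<tau>) \<in> (facet_graph n T)\<^sup>*"
    by (rule Suc.hyps(1)[OF c Suc.prems(1) _ s c2 Suc.prems(5,6)]) (use Suc.prems(2) in blast)
  moreover have "\<sigma> \<inter> ?\<sigma> = \<sigma> - {x}" using y(2) by blast
  then have "(\<sigma>, ?\<sigma>) \<in> facet_graph n T"
    unfolding facet_graph_def using c1 c2 s Suc.prems(2,3,4) by simp
  ultimately show ?case by (rule converse_rtrancl_into_rtrancl[rotated])
qed

definition comparability_graph :: "'a set set \<Rightarrow> ('a set \<times> 'a set) set" where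
  "comparability_graph F = {(B, C). B \<in> F \<and> C \<in> F \<and> (B \<subset> C \<or> C \<subset> B)}"

text \<open>The sets on the path need not be facets, so the induction reaches every facet comparable
  or equal to the current set. Going up, facets inside one set are joined by exchanges; going down,
  two distinct facets over a set of size \<open>n\<close> are adjacent.\<close>

lemma comparability_connected_imp_facet_connected:
  assumes fin: "\<And>B. B \<in> F \<Longrightarrow> finite B \<and> n \<le> card B"
    and down: "\<And>B C. B \<in> F \<Longrightarrow> C \<subseteq> B \<Longrightarrow> n \<le> card C \<Longrightarrow> C \<in> F"
    and \<sigma>: "\<sigma> \<in> F" "card \<sigma> = Suc n"
    and path: "(\<sigma>, B) \<in> (comparability_graph F)\<^sup>*"
    and \<tau>: "\<tau> \<in> F" "card \<tau> = Suc n" "\<tau> \<subseteq> B \<or> B \<subseteq> \<tau>"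
  shows "(\<sigma>, \<tau>) \<in> (facet_graph n {B\<in>F. card B = Suc n})\<^sup>*"
  using path \<tau>
proof (induction arbitrary: \<tau> rule: rtrancl_induct)
  case base
  then have "\<tau> = \<sigma>" using fin \<sigma> by (metis card_subset_eq)
  then show ?case by simp
next
  case (step B C)
  let ?G = "facet_graph n {B\<in>F. card B = Suc n}"
  have BC: "B \<in> F" "C \<in> F" "B \<subset> C \<or> C \<subset> B"
    using step(2) unfolding comparability_graph_def by auto
  show ?case
  proof (cases "B \<subset> C")
    case True
    have fC: "finite C" using fin BC(2) by blast
    have "card B < card C" using True fC psubset_card_mono by blast
    then have c: "Suc n \<le> card C" using fin[OF BC(1)] by simp
    have \<tau>C: "\<tau> \<subseteq> C"
    proof (cases "\<tau> \<subseteq> C")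
      case False
      then have "C \<subseteq> \<tau>" using step.prems by blast
      then have "C = \<tau>" using c step.prems fin[of \<tau>] card_seteq by metis
      then show ?thesis by simp
    qed
    \<comment> \<open>The intermediate facet must lie in \<open>C\<close> and be within reach of the
      induction hypothesis: it is taken inside \<open>B\<close> if \<open>B\<close> is large enough,
      otherwise around \<open>B\<close>.\<close>
    obtain \<tau>0 where t0: "\<tau>0 \<subseteq> C" "card \<tau>0 = Suc n" "\<tau>0 \<subseteq> B \<or> B \<subseteq> \<tau>0"
    proof (cases "Suc n \<le> card B")
      case le: True
      obtain \<tau>0 where "\<tau>0 \<subseteq> B" "card \<tau>0 = Suc n" using obtain_subset_with_card_n[OF le] by metis
      then show ?thesis using that[of \<tau>0] True by blast
    next
      case False
      obtain \<tau>0 where "B \<subseteq> \<tau>0" "\<tau>0 \<subseteq> C" "card \<tau>0 = Suc n"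
        using exists_subset_between[of B "Suc n" C] False True c fC by auto
      then show ?thesis using that by blast
    qed
    have "(\<sigma>, \<tau>0) \<in> ?G\<^sup>*"
      by (rule step.IH) (use down[OF BC(2) t0(1)] t0 in auto)
    moreover have "(\<tau>0, \<tau>) \<in> ?G\<^sup>*"
      by (rule simplex_facet_connected[OF fC _ t0(1,2) \<tau>C step.prems(2)]) (use down[OF BC(2)] in auto)
    ultimately show ?thesis by (rule rtrancl_trans)
  next
    case False
    then have CB: "C \<subset> B" using BC(3) by blast
    show ?thesis
    proof (cases "\<tau> \<subseteq> C")
      case True
      then show ?thesis using step.IH[OF step.prems(1,2)] CB by blast
    next
      case False
      then have C\<tau>: "C \<subset> \<tau>" using step.prems(3) by blast
      then have "card C < Suc n" using step.prems(1,2) fin psubset_card_mono by metis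
      \<comment> \<open>As a proper subset of a facet, \<open>C\<close> has exactly \<open>n\<close>
        vertices; it is the common ridge of \<open>\<tau>\<close> and \<open>\<tau>0\<close> when
        these differ.\<close>
      then have cC: "card C = n" using fin[OF BC(2)] by simp
      have fB: "finite B" using fin[OF BC(1)] by blast
      have "Suc n \<le> card B" using cC psubset_card_mono[OF fB CB] by simp
      then obtain \<tau>0 where t0: "C \<subseteq> \<tau>0" "\<tau>0 \<subseteq> B" "card \<tau>0 = Suc n"
        using exists_subset_between[of C "Suc n" B] CB cC fB by auto
      have t0F: "\<tau>0 \<in> F" using down[OF BC(1) t0(2)] t0(3) by simp
      have r: "(\<sigma>, \<tau>0) \<in> ?G\<^sup>*" using step.IH[OF t0F t0(3)] t0(2) by blast
      show ?thesis
      proof (cases "\<tau>0 = \<tau>")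
        case True
        then show ?thesis using r by simp
      next
        case False
        have ft: "finite \<tau>0" "finite \<tau>" using fin t0F step.prems(1) by blast+
        have "\<tau>0 \<inter> \<tau> \<subset> \<tau>" using False ft t0(3) step.prems(2)
          by (metis card_subset_eq inf_le1 inf_le2 psubsetI)
        then have "card (\<tau>0 \<inter> \<tau>) < Suc n" using psubset_card_mono[OF ft(2)] step.prems(2) by metis
        moreover have "n \<le> card (\<tau>0 \<inter> \<tau>)"
          using card_mono[of "\<tau>0 \<inter> \<tau>" C] t0(1) C\<tau> ft cC by auto
        ultimately have "(\<tau>0, \<tau>) \<in> ?G"
          unfolding facet_graph_def using t0F t0(3) step.prems(1,2) by simp
        then show ?thesis using r by (rule rtrancl_into_rtrancl[rotated])
      qed
    qed
  qed
qed

section \<open>Pure complexes generated by facets of equal size\<close>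

definition generated_complex :: "'a set set \<Rightarrow> 'a set set" where
  "generated_complex T = {\<sigma>. \<sigma> \<noteq> {} \<and> (\<exists>\<tau>\<in>T. \<sigma> \<subseteq> \<tau>)}"

lemma generated_complex_facets:
  assumes "\<And>\<tau>. \<tau> \<in> T \<Longrightarrow> finite \<tau> \<and> card \<tau> = Suc n"
  shows "\<sigma> \<in> generated_complex T \<and> face_dim \<sigma> = int n \<longleftrightarrow> \<sigma> \<in> T"
proof
  assume a: "\<sigma> \<in> generated_complex T \<and> face_dim \<sigma> = int n"
  then obtain \<tau> where t: "\<tau> \<in> T" "\<sigma> \<subseteq> \<tau>" unfolding generated_complex_def by blast
  have "card \<sigma> = Suc n" using a unfolding face_dim_def by simp
  then have "\<sigma> = \<tau>" using t assms by (metis card_subset_eq)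
  then show "\<sigma> \<in> T" using t by simp
next
  assume a: "\<sigma> \<in> T"
  then have "\<sigma> \<noteq> {}" using assms by force
  then show "\<sigma> \<in> generated_complex T \<and> face_dim \<sigma> = int n"
    using a assms unfolding generated_complex_def face_dim_def by auto
qed

text \<open>Every face lies in a member of \<open>T\<close>, which is itself a face; so a maximal
  face is one of these members.\<close>

lemma pure_generated_complex:
  assumes T: "\<And>\<tau>. \<tau> \<in> T \<Longrightarrow> finite \<tau> \<and> card \<tau> = Suc n" and "T \<noteq> {}"
  shows "pure_complex n (generated_complex T)"
proof -
  let ?S = "generated_complex T"
  have facets: "\<tau> \<in> ?S" "face_dim \<tau> = int n" if "\<tau> \<in> T" for \<tau>
    using generated_complex_facets[of T n \<tau>] T that by auto
  have "simplicial_complex ?S"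
    unfolding simplicial_complex_def generated_complex_def
    using T by (auto dest: T intro: finite_subset) (meson order_trans)
  moreover have "face_dim \<sigma> \<le> int n" if \<sigma>: "\<sigma> \<in> ?S" for \<sigma>
  proof -
    obtain \<tau> where "\<tau> \<in> T" "\<sigma> \<subseteq> \<tau>" using \<sigma> unfolding generated_complex_def by blast
    then have "card \<sigma> \<le> Suc n" using T card_mono by metis
    then show ?thesis unfolding face_dim_def by simp
  qed
  moreover have "\<exists>\<sigma>\<in>?S. face_dim \<sigma> = int n" using facets assms(2) by blast
  moreover have "face_dim \<tau> = int n" if "maximal_face ?S \<tau>" for \<tau>
  proof -
    obtain \<tau>' where "\<tau>' \<in> T" "\<tau> \<subseteq> \<tau>'"
      using \<open>maximal_face ?S \<tau>\<close> unfolding maximal_face_def generated_complex_def by blast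
    then have "\<tau>' = \<tau>" using that facets(1) unfolding maximal_face_def by blast
    then show ?thesis using facets(2) \<open>\<tau>' \<in> T\<close> by blast
  qed
  ultimately show ?thesis unfolding pure_complex_def complex_of_dim_def by blast
qed

lemma strongly_connected_generated_complex:
  assumes T: "\<And>\<tau>. \<tau> \<in> T \<Longrightarrow> finite \<tau> \<and> card \<tau> = Suc n"
    and conn: "\<And>\<sigma> \<tau>. \<sigma> \<in> T \<Longrightarrow> \<tau> \<in> T \<Longrightarrow> (\<sigma>, \<tau>) \<in> (facet_graph n T)\<^sup>*"
  shows "strongly_connected n (generated_complex T)"
  unfolding strongly_connected_def
proof (intro ballI impI)
  note facets = generated_complex_facets[of T n, OF T]
  fix \<sigma> \<tau> assume "\<sigma> \<in> generated_complex T" "\<tau> \<in> generated_complex T"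
    "face_dim \<sigma> = int n" "face_dim \<tau> = int n"
  then have "\<sigma> \<in> T" and \<tau>: "\<tau> \<in> T" using facets by blast+
  from conn[OF this] obtain j where "(\<sigma>, \<tau>) \<in> (facet_graph n T) ^^ j"
    using rtrancl_power by blast
  then obtain s where s: "s 0 = \<sigma>" "s j = \<tau>" "\<forall>i<j. (s i, s (Suc i)) \<in> facet_graph n T"
    unfolding relpow_fun_conv by blast
  \<comment> \<open>Membership is read off the edge leaving \<open>s i\<close>, so the last index is
    treated apart.\<close>
  have "s i \<in> T" if "i \<le> j" for i
  proof (cases "i = j")
    case False
    then show ?thesis using s(3) that unfolding facet_graph_def by auto
  qed (use s(2) \<tau> in simp)
  then have "\<forall>i\<le>j. s i \<in> generated_complex T \<and> face_dim (s i) = int n" using facets by blast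
  moreover have "\<forall>i<j. face_dim (s i \<inter> s (Suc i)) = int n - 1"
    using s(3) unfolding facet_graph_def face_dim_def by simp
  ultimately show "\<exists>j s. s 0 = \<sigma> \<and> s j = \<tau> \<and>
      (\<forall>i\<le>j. s i \<in> generated_complex T \<and> face_dim (s i) = int n) \<and>
      (\<forall>i<j. face_dim (s i \<inter> s (Suc i)) = int n - 1)"
    using s(1,2) by blast
qed

lemma card_neighbours_le_vertex_degree:
  assumes "finite S"
  shows "card {u. u \<noteq> v \<and> {u, v} \<in> S} \<le> vertex_degree S v"
  unfolding vertex_degree_def
proof (rule card_inj_on_le)
  show "inj_on (\<lambda>u. {u, v}) {u. u \<noteq> v \<and> {u, v} \<in> S}"
    by (auto simp: inj_on_def doubleton_eq_iff)
  show "(\<lambda>u. {u, v}) ` {u. u \<noteq> v \<and> {u, v} \<in> S} \<subseteq> {e \<in> edges S. v \<in> e}"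
    by (auto simp: edges_def face_dim_def)
  show "finite {e \<in> edges S. v \<in> e}" using assms unfolding edges_def by simp
qed

section \<open>The induction over components\<close>

text \<open>Deleting a vertex can split a component, so the induction treats unions of components in
  the subcomplex induced on an arbitrary \<open>W\<close>. It runs on \<open>card F\<close> and cuts
  \<open>F\<close> into the star of \<open>v\<close> in a component \<open>D\<close>, the rest of
  \<open>D\<close>, and \<open>F - D\<close>.\<close>

lemma comparability_closed_collapses:
  fixes k :: nat and X :: "'a set set"
  assumes "finite X"
    and "clique_complex X"
    and low: "\<And>S. S \<subseteq> X \<Longrightarrow> pure_complex (k + 1) S \<Longrightarrow> strongly_connected (k + 1) S \<Longrightarrow>
           \<exists>v\<in>\<Union> S. vertex_degree S v \<le> 2 * k + 1"
    and "comparability_closed_in F {B\<in>X. B \<subseteq> W \<and> Suc k \<le> card B}"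
  shows "collapses_below (Suc k) F"
  using assms(4)
proof (induction "card F" arbitrary: F W rule: less_induct)
  case less
  let ?P = "\<lambda>W. {B\<in>X. B \<subseteq> W \<and> Suc k \<le> card B}"
  have sc: "simplicial_complex X" using assms(2) unfolding clique_complex_def by blast
  have finX: "finite B" if "B \<in> X" for B using sc that unfolding simplicial_complex_def by blast
  have subX: "C \<in> X" if "B \<in> X" "C \<subseteq> B" "C \<noteq> {}" for B C
    using sc that unfolding simplicial_complex_def by blast
  have FP: "B \<in> X" "B \<subseteq> W" "Suc k \<le> card B" if "B \<in> F" for B
    using subsetD[OF comparability_closed_in_subset[OF less.prems] that] by auto
  have Fcl: "C \<in> F" if "B \<in> F" "C \<in> ?P W" "B \<subset> C \<or> C \<subset> B" for B C
    using comparability_closed_inD[OF less.prems that] .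
  have Fdown: "C \<in> F" if "B \<in> F" "C \<subseteq> B" "Suc k \<le> card C" for B C
  proof (cases "C = B")
    case False
    have "C \<noteq> {}" using that(3) by auto
    then have "C \<in> ?P W" using subX[OF FP(1)[OF that(1)] that(2)] FP(2)[OF that(1)] that by blast
    then show ?thesis using Fcl[OF that(1)] that(2) False by blast
  qed (use that in simp)
  have finF: "finite F" using FP(1) finite_subset[OF _ assms(1)] by blast
  show ?case
  proof (cases "\<exists>A\<in>F. card A = Suc (Suc k)")
    case False
    \<comment> \<open>By downward closure a larger set would contain one of size
      \<open>k + 2\<close>, so nothing has to be collapsed.\<close>
    have "card B \<le> Suc k" if B: "B \<in> F" for B
    proof (rule ccontr)
      assume "\<not> card B \<le> Suc k"
      then obtain A where A: "A \<subseteq> B" "card A = Suc (Suc k)"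
        using obtain_subset_with_card_n[of "Suc (Suc k)" B] by (metis not_less_eq_eq)
      then show False using Fdown[OF B] False by auto
    qed
    then show ?thesis by (rule collapses_below_trivial)
  next
    case True
    then obtain A where A: "A \<in> F" "card A = Suc (Suc k)" by blast
    \<comment> \<open>This is the component of \<open>A\<close>. Its sets of size
      \<open>k + 2\<close> will be the facets of the complex \<open>?S\<close> that supplies the
      low-degree vertex.\<close>
    define D where "D = {B. (A, B) \<in> (comparability_graph F)\<^sup>*}"
    have AD: "A \<in> D" unfolding D_def by simp
    have DF: "D \<subseteq> F"
    proof
      fix B assume "B \<in> D"
      then have "(A, B) \<in> (comparability_graph F)\<^sup>*" unfolding D_def by simp
      then show "B \<in> F" by (cases rule: rtranclE) (use A in \<open>auto simp: comparability_graph_def\<close>)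
    qed
    have DclF: "C \<in> D" if "B \<in> D" "C \<in> F" "B \<subset> C \<or> C \<subset> B" for B C
    proof -
      have "(B, C) \<in> comparability_graph F"
        using that DF unfolding comparability_graph_def by blast
      then show ?thesis using that(1) unfolding D_def by (simp add: rtrancl_into_rtrancl)
    qed
    have Dcl: "comparability_closed_in D (?P W)"
    proof (rule comparability_closed_inI)
      show "D \<subseteq> ?P W" using DF FP by blast
      fix B C assume a: "B \<in> D" "C \<in> ?P W" "B \<subset> C \<or> C \<subset> B"
      then have "C \<in> F" using Fcl[of B C] DF by blast
      then show "C \<in> D" using DclF a by blast
    qed
    have Ddown: "C \<in> D" if "B \<in> D" "C \<subseteq> B" "Suc k \<le> card C" for B C
      using DclF[OF that(1), of C] Fdown[of B C] DF that by (metis psubsetI subsetD)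
    \<comment> \<open>The path stays inside the component, so the facet path derived from it uses
      facets of \<open>D\<close> only.\<close>
    have Dpath: "(A, B) \<in> (comparability_graph D)\<^sup>*" if "B \<in> D" for B
    proof -
      have "(A, B) \<in> (comparability_graph F)\<^sup>*" using that unfolding D_def by simp
      then show ?thesis
      proof (induction rule: rtrancl_induct)
        case (step B C)
        have "B \<in> D" "C \<in> D" using step(1,2) unfolding D_def by auto
        then have "(B, C) \<in> comparability_graph D"
          using step(2) unfolding comparability_graph_def by simp
        then show ?case using step(3) by simp
      qed simp
    qed
    define T where "T = {B\<in>D. card B = Suc (Suc k)}"
    let ?S = "generated_complex T"
    have T: "finite \<tau> \<and> card \<tau> = Suc (Suc k)" if "\<tau> \<in> T" for \<tau>
      using that DF FP(1) finX unfolding T_def by blast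
    have TA: "(A, \<tau>) \<in> (facet_graph (Suc k) T)\<^sup>*" if "\<tau> \<in> T" for \<tau>
      unfolding T_def
    proof (rule comparability_connected_imp_facet_connected[OF _ _ AD A(2) Dpath[of \<tau>]])
      show "finite B \<and> Suc k \<le> card B" if "B \<in> D" for B using that DF FP finX by blast
      show "C \<in> D" if "B \<in> D" "C \<subseteq> B" "Suc k \<le> card C" for B C using Ddown that by blast
    qed (use that in \<open>auto simp: T_def\<close>)
    have "strongly_connected (Suc k) ?S"
    proof (rule strongly_connected_generated_complex[OF T])
      fix \<sigma> \<tau> assume "\<sigma> \<in> T" "\<tau> \<in> T"
      then have "(A, \<tau>) \<in> (facet_graph (Suc k) T)\<^sup>*" "(\<sigma>, A) \<in> (facet_graph (Suc k) T)\<^sup>*"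
        using TA sym_rtrancl[OF sym_facet_graph] unfolding sym_def by blast+
      then show "(\<sigma>, \<tau>) \<in> (facet_graph (Suc k) T)\<^sup>*" by simp
    qed
    moreover have "T \<noteq> {}" using A(2) AD unfolding T_def by blast
    then have "pure_complex (Suc k) ?S" using pure_generated_complex[OF T] by blast
    moreover have SX: "?S \<subseteq> X"
      using subX FP(1) DF unfolding generated_complex_def T_def by blast
    ultimately obtain v where v: "v \<in> \<Union> ?S" "vertex_degree ?S v \<le> 2 * k + 1"
      using low[of ?S] by auto
    obtain \<tau> where \<tau>: "\<tau> \<in> D" "v \<in> \<tau>"
      using v(1) unfolding generated_complex_def T_def by blast
    let ?N = "{u. u \<noteq> v \<and> (\<exists>B\<in>D. card B = k + 2 \<and> u \<in> B \<and> v \<in> B)}"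
    \<comment> \<open>A neighbour seen in a facet spans an edge of \<open>?S\<close> with
      \<open>v\<close>, so the degree of \<open>v\<close> in \<open>?S\<close> bounds the size of
      \<open>?N\<close>.\<close>
    have "?N \<subseteq> {u. u \<noteq> v \<and> {u, v} \<in> ?S}"
      unfolding generated_complex_def T_def by auto
    moreover have finS: "finite ?S" using SX assms(1) finite_subset by blast
    moreover have "finite {u. u \<noteq> v \<and> {u, v} \<in> ?S}"
    proof -
      have "finite (\<Union> X)" using assms(1) finX by blast
      moreover have "{u. u \<noteq> v \<and> {u, v} \<in> ?S} \<subseteq> \<Union> X" using SX by blast
      ultimately show ?thesis using finite_subset by blast
    qed
    ultimately have "card ?N \<le> card {u. u \<noteq> v \<and> {u, v} \<in> ?S}" by (intro card_mono)
    then have "card ?N \<le> 2 * k + 1"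
      using card_neighbours_le_vertex_degree[OF finS, of v] v(2) by simp
    then have star: "collapses_below (Suc k) {B\<in>D. v \<in> B}"
      by (rule few_neighbours_star_collapses[OF assms(2,1) Dcl])
    \<comment> \<open>The family shrinks because \<open>v\<close> lies in the member
      \<open>\<tau>\<close> of \<open>D\<close>.\<close>
    have "card (D - {B\<in>D. v \<in> B}) < card F"
      using \<tau> DF finF by (intro psubset_card_mono) auto
    \<comment> \<open>A face on \<open>W - {v}\<close> comparable to a member of \<open>D\<close>
      lies in \<open>D\<close> and avoids \<open>v\<close>; thus the rest of \<open>D\<close> is
      closed once the ambient vertex set loses \<open>v\<close>.\<close>
    moreover have "comparability_closed_in (D - {B\<in>D. v \<in> B}) (?P (W - {v}))"
    proof (rule comparability_closed_inI)
      show "D - {B\<in>D. v \<in> B} \<subseteq> ?P (W - {v})" using DF FP by blast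
      fix B C assume a: "B \<in> D - {B\<in>D. v \<in> B}" "C \<in> ?P (W - {v})" "B \<subset> C \<or> C \<subset> B"
      have "B \<in> D" "C \<in> ?P W" using a(1,2) by blast+
      then have "C \<in> D" using comparability_closed_inD[OF Dcl] a(3) by blast
      then show "C \<in> D - {B\<in>D. v \<in> B}" using a(2) by blast
    qed
    ultimately have "collapses_below (Suc k) (D - {B\<in>D. v \<in> B})" by (rule less.hyps)
    moreover have DFP: "finite B \<and> Suc k \<le> card B" if "B \<in> F" for B using that FP finX by blast
    moreover have "up_closed_in {B\<in>D. v \<in> B} D" unfolding up_closed_in_def by auto
    ultimately have colD: "collapses_below (Suc k) D"
      using star DF by (intro collapses_below_split[of D "Suc k" "{B\<in>D. v \<in> B}"]) auto
    have "card (F - D) < card F" using A(1) AD finF by (intro psubset_card_mono) auto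
    \<comment> \<open>No comparability joins the component \<open>D\<close> to its complement in
      \<open>F\<close>, so here \<open>W\<close> is unchanged.\<close>
    moreover have "comparability_closed_in (F - D) (?P W)"
    proof (rule comparability_closed_inI)
      show "F - D \<subseteq> ?P W" using FP by blast
      fix B C assume a: "B \<in> F - D" "C \<in> ?P W" "B \<subset> C \<or> C \<subset> B"
      then have "C \<in> F" using Fcl[of B C] by blast
      moreover have "C \<notin> D" using DclF[of C B] a by blast
      ultimately show "C \<in> F - D" by blast
    qed
    ultimately have "collapses_below (Suc k) (F - D)" by (rule less.hyps)
    moreover have "up_closed_in D F" unfolding up_closed_in_def using DF DclF by blast
    ultimately show ?thesis
      using colD DFP by (intro collapses_below_split[of F "Suc k" D])
  qed
qed

section \<open>Return to simplicial collapses of the whole complex\<close>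

text \<open>As the only set strictly above \<open>\<sigma>\<close>, \<open>\<tau>\<close> is
  maximal, while \<open>\<sigma>\<close> is not; so \<open>\<tau>\<close> is the only maximal face
  containing \<open>\<sigma>\<close>. Since the sizes differ by one, the interval consists of just
  these two sets.\<close>

lemma elem_collapse_imp_collapse_step:
  assumes "elem_collapse m S T"
  shows "collapse_step S T"
proof -
  obtain \<sigma> \<tau> where s: "\<sigma> \<in> S" "\<tau> \<in> S" "m \<le> card \<sigma>" "finite \<tau>" "\<sigma> \<subset> \<tau>"
    "card \<tau> = Suc (card \<sigma>)" and uniq: "\<forall>\<rho>\<in>S. \<sigma> \<subset> \<rho> \<longrightarrow> \<rho> = \<tau>" and T: "T = S - {\<sigma>, \<tau>}"
    using assms unfolding elem_collapse_def by blast
  have max: "maximal_face S \<tau>"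
    unfolding maximal_face_def using s(2,5) uniq by (meson psubset_subset_trans)
  have uniq_max: "\<rho> = \<tau>" if "maximal_face S \<rho>" "\<sigma> \<subseteq> \<rho>" for \<rho>
  proof (rule ccontr)
    assume "\<rho> \<noteq> \<tau>"
    have \<rho>: "\<rho> \<in> S" "\<And>\<eta>. \<eta> \<in> S \<Longrightarrow> \<rho> \<subseteq> \<eta> \<Longrightarrow> \<eta> = \<rho>"
      using that(1) unfolding maximal_face_def by simp_all
    have "\<rho> = \<sigma>" using uniq \<rho>(1) \<open>\<rho> \<noteq> \<tau>\<close> that(2) by (metis psubsetI)
    then show False using \<rho>(2)[OF s(2)] s(5) by blast
  qed
  have "free_face S \<sigma> \<tau>"
    unfolding free_face_def by (intro conjI allI impI s(1,5) max uniq_max)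
  moreover have "{\<eta>. \<sigma> \<subseteq> \<eta> \<and> \<eta> \<subseteq> \<tau>} = {\<sigma>, \<tau>}"
  proof -
    have "\<eta> = \<sigma> \<or> \<eta> = \<tau>" if "\<sigma> \<subseteq> \<eta>" "\<eta> \<subseteq> \<tau>" for \<eta>
    proof (rule ccontr)
      assume "\<not> (\<eta> = \<sigma> \<or> \<eta> = \<tau>)"
      then have "\<sigma> \<subset> \<eta>" "\<eta> \<subset> \<tau>" using that by auto
      then have "card \<sigma> < card \<eta>" "card \<eta> < card \<tau>"
        using s(4) finite_subset[OF that(2)] by (simp_all add: psubset_card_mono)
      then show False using s(6) by simp
    qed
    then show ?thesis using s(5) by blast
  qed
  ultimately show ?thesis unfolding collapse_step_def T
    by (intro exI[of _ \<sigma>] exI[of _ \<tau>]) simp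
qed

theorem theorem3p1:
  fixes k :: nat and X :: "'a set set"
  assumes "finite X"
    and "clique_complex X"
    and "\<And>S. S \<subseteq> X \<Longrightarrow> pure_complex (k + 1) S \<Longrightarrow> strongly_connected (k + 1) S \<Longrightarrow>
           \<exists>v\<in>\<Union> S. vertex_degree S v \<le> 2 * k + 1"
  shows "collapsible (k + 1) X"
proof -
  \<comment> \<open>Faces of dimension \<open>k\<close> are included as possible lower sets of
    collapsed pairs; \<open>UNIV\<close> means that no vertex has been deleted yet.\<close>
  let ?F = "{B\<in>X. B \<subseteq> UNIV \<and> Suc k \<le> card B}"
  have F: "comparability_closed_in ?F ?F" by (rule comparability_closed_inI) auto
  have "collapses_below (Suc k) ?F"
    by (rule comparability_closed_collapses[OF assms(1,2) _ F]) (rule assms(3))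
  then obtain F' where F': "(elem_collapse (Suc k))\<^sup>*\<^sup>* ?F F'" "\<forall>\<rho>\<in>F'. card \<rho> \<le> Suc k"
    unfolding collapses_below_def by blast
  have finX: "finite B" if "B \<in> X" for B
    using assms(2) that unfolding clique_complex_def simplicial_complex_def by blast
  \<comment> \<open>A face above a large face is larger still, so collapses of \<open>?F\<close> are
    collapses of \<open>X\<close>.\<close>
  have "up_closed_in ?F X"
    unfolding up_closed_in_def
  proof (intro conjI ballI impI)
    fix \<sigma> \<rho> assume a: "\<sigma> \<in> ?F" "\<rho> \<in> X" "\<sigma> \<subset> \<rho>"
    then have "card \<sigma> < card \<rho>" using finX psubset_card_mono by blast
    then show "\<rho> \<in> ?F" using a by simp
  qed auto
  then have "(elem_collapse (Suc k))\<^sup>*\<^sup>* X (X - (?F - F'))"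
    using elem_collapses_lift[OF F'(1)] by blast
  then have "collapse_step\<^sup>*\<^sup>* X (X - (?F - F'))"
    by (rule rtranclp_mono[THEN predicate2D, rotated]) (use elem_collapse_imp_collapse_step in blast)
  \<comment> \<open>A survivor belongs to \<open>F'\<close> or is too small for \<open>?F\<close>;
    in both cases it has at most \<open>k + 1\<close> vertices.\<close>
  moreover have "face_dim \<sigma> \<le> int (k + 1) - 1" if "\<sigma> \<in> X - (?F - F')" for \<sigma>
    using that F'(2) unfolding face_dim_def by (cases "\<sigma> \<in> F'") auto
  ultimately show ?thesis unfolding collapsible_def by blast
qed

end
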